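(* Let $X$ and $Y$ be Hausdorff spaces with $\mathrm{Emb}(Y)<\infty$, let $\tau:X\to X$ be a fixed-point free involution, and let $q:X\to X/\tau$ be the quotient map. If $\mathrm{secat}(q)>\mathrm{Emb}(Y)$, then the triple $\left((X,\tau);Y\right)$ satisfies the Borsuk-Ulam property (BUP).
   Context: $\mathrm{Emb}(Y)$ is the smallest dimension $k$ of a Euclidean space $\mathbb{R}^k$ in which $Y$ can be (topologically) embedded, and $\mathrm{Emb}(Y)=\infty$ if no such embedding exists. The triple $\left((X,\tau);Y\right)$ satisfies the Borsuk-Ulam property (BUP) if for every continuous map $f:X\to Y$ there exists $x\in X$ with $f(\tau(x))=f(x)$. The sectional category $\mathrm{secat}(q)$ of the 2-sheeted covering $q$ is the minimal cardinality of an open cover of $X/\tau$ such that over each member $U$ there is a continuous local section $s:U\to X$ (i.e. $q\circ s$ is the inclusion of $U$); $\mathrm{secat}(q)=\infty$ if no finite such cover exists. *)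

theory Defs
  imports "HOL-Analysis.Analysis"
begin

definition free_involution :: "'a topology \<Rightarrow> ('a \<Rightarrow> 'a) \<Rightarrow> bool" where
  "free_involution X \<tau> \<longleftrightarrow>
     continuous_map X X \<tau> \<and> (\<forall>x \<in> topspace X. \<tau> (\<tau> x) = x \<and> \<tau> x \<noteq> x)"

definition orbit_map :: "('a \<Rightarrow> 'a) \<Rightarrow> 'a \<Rightarrow> 'a set" where
  "orbit_map \<tau> x = {x, \<tau> x}"

definition orbit_space :: "'a topology \<Rightarrow> ('a \<Rightarrow> 'a) \<Rightarrow> 'a set topology" where
  "orbit_space X \<tau> = topology (\<lambda>U. U \<subseteq> orbit_map \<tau> ` topspace X \<and>
     openin X {x \<in> topspace X. orbit_map \<tau> x \<in> U})"

lemma openin_orbit_space: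
  "openin (orbit_space X \<tau>) U \<longleftrightarrow>
     U \<subseteq> orbit_map \<tau> ` topspace X \<and> openin X {x \<in> topspace X. orbit_map \<tau> x \<in> U}"
proof -
  have "istopology (\<lambda>U. U \<subseteq> orbit_map \<tau> ` topspace X \<and>
     openin X {x \<in> topspace X. orbit_map \<tau> x \<in> U})" (is "istopology ?P")
    unfolding istopology_def
  proof (intro conjI allI impI)
    fix S T assume "?P S" "?P T"
    moreover have "{x \<in> topspace X. orbit_map \<tau> x \<in> S \<inter> T} =
      {x \<in> topspace X. orbit_map \<tau> x \<in> S} \<inter> {x \<in> topspace X. orbit_map \<tau> x \<in> T}" by auto
    ultimately show "S \<inter> T \<subseteq> orbit_map \<tau> ` topspace X"
      and "openin X {x \<in> topspace X. orbit_map \<tau> x \<in> S \<inter> T}" by auto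
  next
    fix K assume K: "\<forall>S\<in>K. ?P S"
    then show "\<Union>K \<subseteq> orbit_map \<tau> ` topspace X" by blast
    have "{x \<in> topspace X. orbit_map \<tau> x \<in> \<Union>K} =
      \<Union>((\<lambda>S. {x \<in> topspace X. orbit_map \<tau> x \<in> S}) ` K)" by auto
    with K show "openin X {x \<in> topspace X. orbit_map \<tau> x \<in> \<Union>K}" by auto
  qed
  then show ?thesis
    unfolding orbit_space_def by (simp add: topology_inverse')
qed

lemma topspace_orbit_space: "topspace (orbit_space X \<tau>) = orbit_map \<tau> ` topspace X"
proof
  show "topspace (orbit_space X \<tau>) \<subseteq> orbit_map \<tau> ` topspace X"
    using openin_orbit_space openin_topspace by blast
  have "{x \<in> topspace X. orbit_map \<tau> x \<in> orbit_map \<tau> ` topspace X} = topspace X" by auto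
  then have "openin (orbit_space X \<tau>) (orbit_map \<tau> ` topspace X)"
    by (simp add: openin_orbit_space)
  then show "orbit_map \<tau> ` topspace X \<subseteq> topspace (orbit_space X \<tau>)"
    by (rule openin_subset)
qed

lemma quotient_map_orbit_map: "quotient_map X (orbit_space X \<tau>) (orbit_map \<tau>)"
  by (auto simp: quotient_map_def topspace_orbit_space openin_orbit_space)

(* In both definitions below, the infimum of the empty set of extended naturals is \<infinity>. *)

definition secat :: "'a topology \<Rightarrow> 'b topology \<Rightarrow> ('a \<Rightarrow> 'b) \<Rightarrow> enat" where
  "secat X B q = Inf {enat (card \<U>) | \<U>. finite \<U> \<and> \<Union>\<U> = topspace B \<and>
     (\<forall>U \<in> \<U>. openin B U \<and>
        (\<exists>s. continuous_map (subtopology B U) X s \<and> (\<forall>b \<in> U. q (s b) = b)))}"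

definition Emb :: "'a topology \<Rightarrow> enat" where
  "Emb Y = Inf {enat k | k. \<exists>e. embedding_map Y (Euclidean_space k) e}"

definition Borsuk_Ulam_property :: "'a topology \<Rightarrow> ('a \<Rightarrow> 'a) \<Rightarrow> 'b topology \<Rightarrow> bool" where
  "Borsuk_Ulam_property X \<tau> Y \<longleftrightarrow>
     (\<forall>f. continuous_map X Y f \<longrightarrow> (\<exists>x \<in> topspace X. f (\<tau> x) = f x))"

end

theory Submission
  imports Defs
begin

text \<open>
  Argue by contraposition. Suppose \<open>f : X \<rightarrow> Y\<close> satisfies \<open>f (\<tau> x) \<noteq> f x\<close> everywhere, and follow \<open>f\<close>
  with an embedding of \<open>Y\<close> in \<open>\<real>\<^sup>k\<close>, where \<open>k = Emb Y\<close>. The coordinate differences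
  \<open>h i x = g i x - g i (\<tau> x)\<close> of the resulting map \<open>g\<close> are odd, that is, \<open>h i (\<tau> x) = - h i x\<close>,
  and by injectivity of the embedding they have no common zero. An odd real function selects, from
  every orbit on which it does not vanish, the point where it is positive, and this selection is
  continuous (lemma \<open>local_section_if_odd\<close>). So the \<open>k\<close> images in \<open>X/\<tau>\<close> of the sets \<open>{h i \<noteq> 0}\<close>
  form an open cover with local sections, and the sectional category is at most \<open>k\<close>
  (lemma \<open>secat_le_if_no_coincidence\<close>).
\<close>

lemma orbit_map_eq_iff:
  assumes "free_involution X \<tau>" "x \<in> topspace X" "y \<in> topspace X"
  shows "orbit_map \<tau> x = orbit_map \<tau> y \<longleftrightarrow> x = y \<or> x = \<tau> y"
  using assms unfolding free_involution_def orbit_map_def by (auto simp: doubleton_eq_iff)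

text \<open>The saturation of an open set \<open>W\<close> is the union of \<open>W\<close> and its preimage under \<open>\<tau>\<close>.\<close>

lemma open_map_orbit_map:
  assumes \<tau>: "free_involution X \<tau>"
  shows "open_map X (orbit_space X \<tau>) (orbit_map \<tau>)"
  unfolding open_map_def
proof (intro allI impI)
  fix W assume W: "openin X W"
  have sub: "W \<subseteq> topspace X"
    using W by (rule openin_subset)
  have "{x \<in> topspace X. orbit_map \<tau> x \<in> orbit_map \<tau> ` W} = W \<union> {x \<in> topspace X. \<tau> x \<in> W}"
  proof -
    have "orbit_map \<tau> x \<in> orbit_map \<tau> ` W \<longleftrightarrow> x \<in> W \<or> \<tau> x \<in> W" if x: "x \<in> topspace X" for x
    proof -
      have "orbit_map \<tau> x \<in> orbit_map \<tau> ` W \<longleftrightarrow> (\<exists>w\<in>W. x = w \<or> x = \<tau> w)"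
        using orbit_map_eq_iff[OF \<tau> x] sub by blast
      also have "\<dots> \<longleftrightarrow> x \<in> W \<or> \<tau> x \<in> W"
        using \<tau> x sub unfolding free_involution_def by (metis subsetD)
      finally show ?thesis .
    qed
    then show ?thesis
      using sub by blast
  qed
  moreover have "openin X {x \<in> topspace X. \<tau> x \<in> W}"
    using \<tau> W unfolding free_involution_def by (blast intro: openin_continuous_map_preimage)
  ultimately show "openin (orbit_space X \<tau>) (orbit_map \<tau> ` W)"
    unfolding openin_orbit_space using W sub by auto
qed

text \<open>
  Exactly one of \<open>h x\<close> and \<open>h (\<tau> x) = - h x\<close> is positive when \<open>h x \<noteq> 0\<close>, so the quotient map restricts
  to a continuous bijection from \<open>{h > 0}\<close> onto the image of \<open>{h \<noteq> 0}\<close>. It is an open map, hence its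
  inverse is a continuous section.
\<close>

lemma local_section_if_odd:
  fixes h :: "'a \<Rightarrow> real"
  assumes \<tau>: "free_involution X \<tau>"
    and h: "continuous_map X euclideanreal h"
    and odd: "\<And>x. x \<in> topspace X \<Longrightarrow> h (\<tau> x) = - h x"
  defines "U \<equiv> orbit_map \<tau> ` {x \<in> topspace X. h x \<noteq> 0}"
  shows "openin (orbit_space X \<tau>) U"
    and "\<exists>s. continuous_map (subtopology (orbit_space X \<tau>) U) X s \<and> (\<forall>b\<in>U. orbit_map \<tau> (s b) = b)"
proof -
  define P where "P = {x \<in> topspace X. h x \<in> {0<..}}"
  have "openin X {x \<in> topspace X. h x \<in> - {0}}"
    using h by (rule openin_continuous_map_preimage) (simp add: open_openin[symmetric] open_Compl)
  then show U: "openin (orbit_space X \<tau>) U"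
    using open_map_orbit_map[OF \<tau>] unfolding U_def open_map_def by simp
  have P: "openin X P"
    unfolding P_def using h by (rule openin_continuous_map_preimage) (simp add: open_openin[symmetric])
  have \<tau>_in: "\<tau> x \<in> topspace X" "\<tau> (\<tau> x) = x" if "x \<in> topspace X" for x
    using \<tau> that by (auto simp: free_involution_def continuous_map_def)
  have "inj_on (orbit_map \<tau>) P"
  proof (rule inj_onI)
    fix x y assume xy: "x \<in> P" "y \<in> P" "orbit_map \<tau> x = orbit_map \<tau> y"
    then have "x = y \<or> x = \<tau> y"
      using orbit_map_eq_iff[OF \<tau>] by (simp add: P_def)
    then show "x = y"
      using xy odd[of y] by (auto simp: P_def)
  qed
  have image: "orbit_map \<tau> ` P = U"
  proof
    show "orbit_map \<tau> ` P \<subseteq> U"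
      unfolding U_def P_def by auto
    show "U \<subseteq> orbit_map \<tau> ` P"
    proof
      fix b assume "b \<in> U"
      then obtain x where x: "x \<in> topspace X" "h x \<noteq> 0" "b = orbit_map \<tau> x"
        unfolding U_def by blast
      have "orbit_map \<tau> (\<tau> x) = orbit_map \<tau> x"
        using orbit_map_eq_iff[OF \<tau>] \<tau>_in x by blast
      moreover have "x \<in> P \<or> \<tau> x \<in> P"
        using x odd[of x] \<tau>_in[of x] by (auto simp: P_def)
      ultimately show "b \<in> orbit_map \<tau> ` P"
        using x(3) by (metis imageI)
    qed
  qed
  define s where "s = the_inv_into P (orbit_map \<tau>)"
  have s_orbit: "s (orbit_map \<tau> x) = x" if "x \<in> P" for x
    using that \<open>inj_on (orbit_map \<tau>) P\<close> unfolding s_def by (simp add: the_inv_into_f_f)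
  then have s: "s b \<in> P" "orbit_map \<tau> (s b) = b" if "b \<in> U" for b
    using that unfolding image[symmetric] by auto
  have "continuous_map (subtopology (orbit_space X \<tau>) U) X s"
    unfolding continuous_map
  proof (intro conjI allI impI)
    have topU: "topspace (subtopology (orbit_space X \<tau>) U) = U"
      using openin_subset[OF U] by auto
    show "s ` topspace (subtopology (orbit_space X \<tau>) U) \<subseteq> topspace X"
      unfolding topU using s(1) by (auto simp: P_def)
    fix V assume V: "openin X V"
    have "{b \<in> topspace (subtopology (orbit_space X \<tau>) U). s b \<in> V} = orbit_map \<tau> ` (P \<inter> V)"
    proof
      show "{b \<in> topspace (subtopology (orbit_space X \<tau>) U). s b \<in> V} \<subseteq> orbit_map \<tau> ` (P \<inter> V)"
        unfolding topU using s by (auto intro!: rev_image_eqI)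
      show "orbit_map \<tau> ` (P \<inter> V) \<subseteq> {b \<in> topspace (subtopology (orbit_space X \<tau>) U). s b \<in> V}"
        unfolding topU using image s_orbit by auto
    qed
    moreover have "openin (orbit_space X \<tau>) (orbit_map \<tau> ` (P \<inter> V))"
      using open_map_orbit_map[OF \<tau>] P V unfolding open_map_def by blast
    moreover have "orbit_map \<tau> ` (P \<inter> V) \<subseteq> U"
      using image by blast
    ultimately show
      "openin (subtopology (orbit_space X \<tau>) U) {b \<in> topspace (subtopology (orbit_space X \<tau>) U). s b \<in> V}"
      using U by (simp add: openin_open_subtopology)
  qed
  then show "\<exists>s. continuous_map (subtopology (orbit_space X \<tau>) U) X s \<and> (\<forall>b\<in>U. orbit_map \<tau> (s b) = b)"
    using s(2) by blast
qed

lemma secat_le_if_no_coincidence: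
  assumes \<tau>: "free_involution X \<tau>"
    and g: "continuous_map X (Euclidean_space k) g"
    and free: "\<And>x. x \<in> topspace X \<Longrightarrow> g (\<tau> x) \<noteq> g x"
  shows "secat X (orbit_space X \<tau>) (orbit_map \<tau>) \<le> enat k"
proof -
  have g_prod: "continuous_map X (powertop_real UNIV) g"
    using g unfolding Euclidean_space_def continuous_map_in_subtopology by blast
  then have g_coord: "continuous_map X euclideanreal (\<lambda>x. g x i)" for i
    by (simp add: continuous_map_componentwise_UNIV)
  have g_tail: "g x i = 0" if "x \<in> topspace X" "k \<le> i" for x i
    using continuous_map_image_subset_topspace[OF g] that by (auto simp: topspace_Euclidean_space)
  have \<tau>_cont: "continuous_map X X \<tau>" and \<tau>_inv: "\<And>x. x \<in> topspace X \<Longrightarrow> \<tau> (\<tau> x) = x"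
    using \<tau> by (auto simp: free_involution_def)
  have \<tau>_in: "\<tau> x \<in> topspace X" if "x \<in> topspace X" for x
    using \<tau>_cont that by (auto simp: continuous_map_def)
  define h where "h i x = g x i - g (\<tau> x) i" for i x
  have h: "continuous_map X euclideanreal (h i)" for i
    using continuous_map_compose[OF \<tau>_cont g_coord[of i]] unfolding h_def[abs_def] o_def
    by (intro continuous_map_diff g_coord)
  have odd: "h i (\<tau> x) = - h i x" if "x \<in> topspace X" for i x
    using \<tau>_inv[OF that] by (simp add: h_def)
  define U where "U i = orbit_map \<tau> ` {x \<in> topspace X. h i x \<noteq> 0}" for i
  note sections = local_section_if_odd[OF \<tau> h odd, folded U_def]
  have nonzero: "\<exists>i<k. h i x \<noteq> 0" if x: "x \<in> topspace X" for x
  proof -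
    obtain i where i: "g (\<tau> x) i \<noteq> g x i"
      using free[OF x] by blast
    then have "i < k"
      using g_tail[of x i] g_tail[of "\<tau> x" i] x \<tau>_in by (metis leI)
    then show ?thesis
      using i by (auto simp: h_def)
  qed
  have cover: "\<Union>(U ` {..<k}) = topspace (orbit_space X \<tau>)"
    using nonzero unfolding topspace_orbit_space U_def by fastforce
  have "secat X (orbit_space X \<tau>) (orbit_map \<tau>) \<le> enat (card (U ` {..<k}))"
    unfolding secat_def
  proof (rule Inf_lower, rule CollectI, intro exI conjI)
    show "\<forall>V\<in>U ` {..<k}. openin (orbit_space X \<tau>) V \<and>
        (\<exists>s. continuous_map (subtopology (orbit_space X \<tau>) V) X s \<and> (\<forall>b\<in>V. orbit_map \<tau> (s b) = b))"
      using sections by blast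
  qed (use cover in auto)
  also have "\<dots> \<le> enat k"
    using card_image_le[of "{..<k}" U] by simp
  finally show ?thesis .
qed

text \<open>The infimum is attained because the extended naturals are well-ordered.\<close>

lemma embedding_map_Emb:
  assumes "Emb Y < \<infinity>"
  obtains k e where "Emb Y = enat k" "embedding_map Y (Euclidean_space k) e"
proof -
  let ?K = "{enat k | k. \<exists>e. embedding_map Y (Euclidean_space k) e}"
  have "?K \<noteq> {}"
  proof
    assume "?K = {}"
    then have "Emb Y = \<infinity>"
      unfolding Emb_def by (simp only: Inf_enat_def if_True simp_thms)
    then show False
      using assms by simp
  qed
  then have "Emb Y \<in> ?K"
    unfolding Emb_def by (metis (no_types, lifting) wellorder_InfI ex_in_conv)
  then show thesis
    using that by blast
qed

theorem proposition3p19: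
  fixes X :: "'a topology" and Y :: "'b topology" and \<tau> :: "'a \<Rightarrow> 'a"
  assumes "Hausdorff_space X" and "Hausdorff_space Y"
    and "Emb Y < \<infinity>"
    and "free_involution X \<tau>"
    and "secat X (orbit_space X \<tau>) (orbit_map \<tau>) > Emb Y"
  shows "Borsuk_Ulam_property X \<tau> Y"
  unfolding Borsuk_Ulam_property_def
proof (intro allI impI, rule ccontr)
  fix f assume f: "continuous_map X Y f" and free: "\<not> (\<exists>x\<in>topspace X. f (\<tau> x) = f x)"
  obtain k e where k: "Emb Y = enat k" and e: "embedding_map Y (Euclidean_space k) e"
    using embedding_map_Emb[OF assms(3)] .
  have e_inj: "inj_on e (topspace Y)"
    using e unfolding embedding_map_def homeomorphic_eq_everything_map by blast
  have e_cont: "continuous_map Y (Euclidean_space k) e"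
    using e by (meson continuous_map_in_subtopology embedding_map_def homeomorphic_imp_continuous_map)
  have "(e \<circ> f) (\<tau> x) \<noteq> (e \<circ> f) x" if x: "x \<in> topspace X" for x
  proof -
    have "\<tau> x \<in> topspace X"
      using assms(4) x by (auto simp: free_involution_def continuous_map_def)
    then have "f x \<in> topspace Y" "f (\<tau> x) \<in> topspace Y"
      using f x by (auto simp: continuous_map_def)
    then show ?thesis
      using free x e_inj by (auto dest: inj_onD)
  qed
  then have "secat X (orbit_space X \<tau>) (orbit_map \<tau>) \<le> enat k"
    using secat_le_if_no_coincidence[OF assms(4)]
      continuous_map_compose[OF f e_cont] by blast
  then show False
    using assms(5) k by simp
qed

end
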